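(* Let $p\in\mathbb{Z}$, $p>0$, be a positive integer and let $\lambda=(\lambda_1,\ldots,\lambda_n)\in\mathbb{Z}^n$ be a strict partition. Then, with $(-p)\lambda:=(-p,\lambda_1,\ldots,\lambda_n)$, $$Q_{(-p)\lambda}=(-1)^{p+\operatorname{ind}(\lambda,p)+1}\,2\,Q_{\lambda\setminus\{p\}}.$$
   Context: Let $x_1,x_2,\ldots$ be variables and define symmetric functions $q_n$ ($n\in\mathbb{Z}$) by $\prod_{i\ge1}\frac{1+zx_i}{1-zx_i}=\sum_{n\in\mathbb{Z}}q_nz^n$; so $q_0=1$ and $q_n=0$ for $n<0$. For $r,s\in\mathbb{Z}$ put $Q_{(r,s)}:=q_rq_s+2\sum_{i=1}^s(-1)^iq_{r+i}q_{s-i}$ (the sum is empty if $s<1$). A composition is a finite sequence of (possibly negative) integers; a partition is a weakly decreasing composition with nonnegative parts; it is strict if its nonzero parts are distinct. For a composition $\nu=(\nu_1,\ldots,\nu_N)$ let $M(\nu)$ be the $N\times N$ skew-symmetric matrix with $ij$-entry $Q_{(\nu_i,\nu_j)}$ if $i<j$, $0$ if $i=j$, and $-Q_{(\nu_j,\nu_i)}$ if $i>j$. For $\lambda\in\mathbb{Z}^n$ put $\lambda0:=(\lambda_1,\ldots,\lambda_n,0)$ and define $Q_\lambda:=\operatorname{Pf}M(\lambda)$ if $n$ is even and $Q_\lambda:=\operatorname{Pf}M(\lambda0)$ if $n$ is odd. Here $\operatorname{Pf}$ is the Pfaffian, normalized by $\operatorname{Pf}M=\sum_{j=2}^{2N}(-1)^jm_{1j}\operatorname{Pf}M_{1j}$,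 where $M_{1j}$ is $M$ with rows and columns $1,j$ deleted; the empty Pfaffian is $1$ (so $Q$ of the empty composition is $1$). For a strict composition $\lambda$ and integer $p$: $\operatorname{ind}(\lambda,p):=i$ if $p=\lambda_i$ for some $i$, and $0$ otherwise; $Q_{\lambda\setminus\{p\}}:=Q_{(\lambda_1,\ldots,\lambda_{i-1},\lambda_{i+1},\ldots,\lambda_n)}$ if $p=\lambda_i$, and $Q_{\lambda\setminus\{p\}}:=0$ if $p$ is not a part of $\lambda$. *)

theory Defs
  imports
    "HOL-Computational_Algebra.Formal_Power_Series"
    "HOL-Library.Poly_Mapping"
    "Jordan_Normal_Form.Determinant"
begin

(* Formal power series in countably many variables x_0, x_1, ...: a series assigns a coefficient
   to every monomial, and a monomial is a finitely supported exponent vector.  This ring contains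
   the symmetric functions. *)

typedef 'a mps = "UNIV :: ((nat \<Rightarrow>\<^sub>0 nat) \<Rightarrow> 'a) set"
  morphisms mps_nth Abs_mps
  by simp

declare Abs_mps_inverse [OF UNIV_I, simp]

lemma mps_eqI: "(\<And>m. mps_nth f m = mps_nth g m) \<Longrightarrow> f = g"
  by (simp add: mps_nth_inject [symmetric] fun_eq_iff)

definition monom_splits :: "(nat \<Rightarrow>\<^sub>0 nat) \<Rightarrow> ((nat \<Rightarrow>\<^sub>0 nat) \<times> (nat \<Rightarrow>\<^sub>0 nat)) set"
  where "monom_splits m = {(a, b). a + b = m}"

lemma finite_monom_splits [simp]:
  fixes m :: "nat \<Rightarrow>\<^sub>0 nat"
  shows "finite (monom_splits m)"
proof -
  let ?M = "Max (Poly_Mapping.lookup m ` Poly_Mapping.keys m)"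
  let ?F = "{f :: nat \<Rightarrow> nat. \<forall>x. (x \<in> Poly_Mapping.keys m \<longrightarrow> f x \<in> {..?M}) \<and> (x \<notin> Poly_Mapping.keys m \<longrightarrow> f x = 0)}"
  have F: "finite ?F"
    by (rule finite_set_of_finite_funs) auto
  have sub: "Poly_Mapping.lookup a \<in> ?F" if "a + b = m" for a b :: "nat \<Rightarrow>\<^sub>0 nat"
  proof -
    have le: "Poly_Mapping.lookup a x \<le> Poly_Mapping.lookup m x" for x
      using that by (auto simp: lookup_add)
    have "Poly_Mapping.lookup m x \<le> ?M" if "x \<in> Poly_Mapping.keys m" for x
      using that by (intro Max_ge) auto
    moreover have zero: "Poly_Mapping.lookup a x = 0" if "x \<notin> Poly_Mapping.keys m" for x
      using le [of x] that by (simp add: in_keys_iff)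
    ultimately have "Poly_Mapping.lookup a x \<le> ?M" if "x \<in> Poly_Mapping.keys m" for x
      using le [of x] that by (meson order_trans)
    with zero show ?thesis
      by simp
  qed
  have "Poly_Mapping.lookup ` fst ` monom_splits m \<subseteq> ?F"
    using sub by (auto simp: monom_splits_def)
  then have "finite (Poly_Mapping.lookup ` fst ` monom_splits m)"
    using F finite_subset by blast
  then have "finite (fst ` monom_splits m)"
    by (rule finite_imageD) (simp add: inj_on_def)
  moreover have "inj_on fst (monom_splits m)"
    by (auto simp: inj_on_def monom_splits_def)
  ultimately show ?thesis
    by (rule finite_imageD)
qed

instantiation mps :: (comm_ring_1) comm_ring_1
begin

definition "0 = Abs_mps (\<lambda>m. 0)"
definition "1 = Abs_mps (\<lambda>m. if m = 0 then 1 else 0)"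
definition "f + g = Abs_mps (\<lambda>m. mps_nth f m + mps_nth g m)"
definition "f - g = Abs_mps (\<lambda>m. mps_nth f m - mps_nth g m)"
definition "- f = Abs_mps (\<lambda>m. - mps_nth f m)"
definition "f * g = Abs_mps (\<lambda>m. \<Sum>(a, b)\<in>monom_splits m. mps_nth f a * mps_nth g b)"

instance
proof
  fix f g h :: "'a mps"
  show "f + g + h = f + (g + h)" "f + g = g + f" "0 + f = f" "- f + f = 0" "f - g = f + - g"
    by (simp_all add: plus_mps_def zero_mps_def uminus_mps_def minus_mps_def
        algebra_simps mps_nth_inverse)
  show "(0::'a mps) \<noteq> 1"
  proof
    assume "(0::'a mps) = 1"
    then have "mps_nth (0::'a mps) 0 = mps_nth 1 0" by simp
    then show False by (simp add: zero_mps_def one_mps_def)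
  qed
  show "(f + g) * h = f * h + g * h"
    by (simp add: plus_mps_def times_mps_def sum.distrib [symmetric] algebra_simps
        case_prod_unfold)
  show "f * g = g * f"
  proof (rule mps_eqI)
    fix m
    have "(\<Sum>(a, b)\<in>monom_splits m. mps_nth f a * mps_nth g b) =
        (\<Sum>(a, b)\<in>monom_splits m. mps_nth g a * mps_nth f b)"
      by (rule sum.reindex_bij_witness [where i = prod.swap and j = prod.swap])
        (auto simp: monom_splits_def ac_simps)
    then show "mps_nth (f * g) m = mps_nth (g * f) m"
      by (simp add: times_mps_def)
  qed
  show "1 * f = f"
  proof (rule mps_eqI)
    fix m
    have "(\<Sum>(a, b)\<in>monom_splits m. mps_nth 1 a * mps_nth f b) =
        (\<Sum>(a, b)\<in>{(0, m)}. mps_nth 1 a * mps_nth f b)"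
      by (rule sum.mono_neutral_right)
        (auto simp: monom_splits_def one_mps_def finite_monom_splits [unfolded monom_splits_def]
          split: if_splits)
    then show "mps_nth (1 * f) m = mps_nth f m"
      by (simp add: times_mps_def one_mps_def)
  qed
  show "f * g * h = f * (g * h)"
  proof (rule mps_eqI)
    fix m
    have "mps_nth (f * g * h) m =
      (\<Sum>p\<in>monom_splits m. \<Sum>r\<in>monom_splits (fst p).
         mps_nth f (fst r) * mps_nth g (snd r) * mps_nth h (snd p))"
      by (simp add: times_mps_def sum_distrib_right case_prod_unfold)
    also have "\<dots> = (\<Sum>(p, r)\<in>(SIGMA p:monom_splits m. monom_splits (fst p)).
         mps_nth f (fst r) * mps_nth g (snd r) * mps_nth h (snd p))"
      by (rule sum.Sigma) auto
    also have "\<dots> = (\<Sum>(p, r)\<in>(SIGMA p:monom_splits m. monom_splits (snd p)).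
         mps_nth f (fst p) * (mps_nth g (fst r) * mps_nth h (snd r)))"
      by (rule sum.reindex_bij_witness
          [where i = "\<lambda>((a, b), (c, d)). ((a + c, d), (a, c))"
            and j = "\<lambda>((a, b), (c, d)). ((c, d + b), (d, b))"])
        (auto simp: monom_splits_def ac_simps)
    also have "\<dots> = (\<Sum>p\<in>monom_splits m. \<Sum>r\<in>monom_splits (snd p).
         mps_nth f (fst p) * (mps_nth g (fst r) * mps_nth h (snd r)))"
      by (rule sum.Sigma [symmetric]) auto
    also have "\<dots> = mps_nth (f * (g * h)) m"
      by (simp add: times_mps_def sum_distrib_left case_prod_unfold)
    finally show "mps_nth (f * g * h) m = mps_nth (f * (g * h)) m" .
  qed
qed

end

definition mps_var :: "nat \<Rightarrow> 'a::comm_ring_1 mps"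
  where "mps_var i = Abs_mps (\<lambda>m. if m = Poly_Mapping.single i 1 then 1 else 0)"

(* (1 + z x_i) / (1 - z x_i), with z = fps_X.  The constant coefficient of the denominator is 1;
   division of fps is not available because mps is not a field. *)

definition q_factor :: "nat \<Rightarrow> int mps fps"
  where "q_factor i =
    (1 + fps_X * fps_const (mps_var i)) *
    fps_right_inverse (1 - fps_X * fps_const (mps_var i)) 1"

lemma q_factor_denominator:
  fixes x :: "int mps"
  shows "(1 - fps_X * fps_const x) * fps_right_inverse (1 - fps_X * fps_const x) 1 = 1"
  by (rule fps_right_inverse) simp

(* The infinite product over all i, taken coefficientwise: the coefficient of z^n times a monomial m
   is the limit of the corresponding coefficients of the finite products.  The topology of int is
   discrete, so the sequence is eventually constant; the limit exists by q_gen_convergent. *)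

definition q_gen :: "int mps fps"
  where "q_gen =
    Abs_fps (\<lambda>n. Abs_mps (\<lambda>m. lim (\<lambda>k. mps_nth (fps_nth (\<Prod>i<k. q_factor i) n) m)))"

definition q :: "int \<Rightarrow> int mps"
  where "q n = (if n < 0 then 0 else fps_nth q_gen (nat n))"

lemma q_factor_nth:
  "fps_nth (q_factor i) n = (if n = 0 then 1 else 2 * mps_var i ^ n)"
proof -
  let ?x = "mps_var i :: int mps"
  have inv: "fps_right_inverse (1 - fps_X * fps_const ?x) 1 = Abs_fps (\<lambda>n. ?x ^ n)" (is "?r = ?g")
  proof -
    have "(1 - fps_X * fps_const ?x) * ?g = 1"
    proof (rule fps_ext)
      fix n
      show "fps_nth ((1 - fps_X * fps_const ?x) * ?g) n = fps_nth 1 n"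
        by (cases n) (simp_all add: left_diff_distrib mult.assoc)
    qed
    then have "?r = ?r * ((1 - fps_X * fps_const ?x) * ?g)"
      by simp
    also have "\<dots> = ((1 - fps_X * fps_const ?x) * ?r) * ?g"
      by (simp only: mult_ac)
    finally show ?thesis
      by (simp only: q_factor_denominator mult_1)
  qed
  show ?thesis
    unfolding q_factor_def inv
    by (cases n) (simp_all add: distrib_right mult.assoc)
qed

lemma mps_var_mult_nth_eq_0:
  fixes m :: "nat \<Rightarrow>\<^sub>0 nat"
  assumes "Poly_Mapping.lookup m i = 0"
  shows "mps_nth (mps_var i * f) m = 0"
proof -
  have "a \<noteq> Poly_Mapping.single i 1" if "(a, b) \<in> monom_splits m" for a b :: "nat \<Rightarrow>\<^sub>0 nat"
  proof
    assume "a = Poly_Mapping.single i 1"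
    moreover have "Poly_Mapping.lookup a i \<le> Poly_Mapping.lookup m i"
      using that by (auto simp: monom_splits_def lookup_add)
    ultimately show False
      using assms by simp
  qed
  then show ?thesis
    by (auto simp: times_mps_def mps_var_def intro!: sum.neutral)
qed

lemma mps_nth_sum: "mps_nth (\<Sum>x\<in>A. f x) m = (\<Sum>x\<in>A. mps_nth (f x) m)"
  by (induction A rule: infinite_finite_induct) (simp_all add: zero_mps_def plus_mps_def)

lemma q_factor_mult_nth:
  fixes m :: "nat \<Rightarrow>\<^sub>0 nat"
  assumes "Poly_Mapping.lookup m i = 0"
  shows "mps_nth (fps_nth (P * q_factor i) n) m = mps_nth (fps_nth P n) m"
proof -
  have "mps_nth (fps_nth P j * fps_nth (q_factor i) (n - j)) m =
      (if j = n then mps_nth (fps_nth P j) m else 0)" if "j \<le> n" for j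
  proof (cases "j = n")
    case False
    then have "fps_nth P j * fps_nth (q_factor i) (n - j) =
        mps_var i * (2 * mps_var i ^ (n - j - 1) * fps_nth P j)"
      using that by (cases "n - j") (simp_all add: q_factor_nth mult_ac)
    then show ?thesis
      using assms False by (simp add: mps_var_mult_nth_eq_0)
  qed (simp add: q_factor_nth)
  then show ?thesis
    by (simp add: fps_mult_nth mps_nth_sum)
qed

lemma q_gen_convergent:
  fixes m :: "nat \<Rightarrow>\<^sub>0 nat"
  shows "convergent (\<lambda>k. mps_nth (fps_nth (\<Prod>i<k. q_factor i) n) m)"
proof -
  obtain K where K: "\<And>i. i \<ge> K \<Longrightarrow> Poly_Mapping.lookup m i = 0"
  proof -
    obtain K where "\<forall>i\<in>Poly_Mapping.keys m. i < K"
      using finite_keys [of m] unfolding finite_nat_set_iff_bounded by blast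
    then show ?thesis
      by (intro that [of K]) (auto simp: in_keys_iff linorder_not_less [symmetric])
  qed
  have "mps_nth (fps_nth (\<Prod>i<k. q_factor i) n) m = mps_nth (fps_nth (\<Prod>i<K. q_factor i) n) m"
    if "k \<ge> K" for k
    using that
  proof (induction k rule: dec_induct)
    case (step k)
    then show ?case
      using q_factor_mult_nth [OF K, of k] by simp
  qed simp
  then have "(\<lambda>k. mps_nth (fps_nth (\<Prod>i<k. q_factor i) n) m)
      \<longlonglongrightarrow> mps_nth (fps_nth (\<Prod>i<K. q_factor i) n) m"
    by (intro tendsto_eventually eventually_sequentiallyI)
  then show ?thesis
    by (rule convergentI)
qed

definition Q2 :: "int \<Rightarrow> int \<Rightarrow> int mps"
  where "Q2 r s = q r * q s + 2 * (\<Sum>i = 1..s. (-1) ^ nat i * q (r + i) * q (s - i))"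

(* Expansion along the first row.  With 0-based indices the sign (-1)^j of the entry m_1j becomes
   (-1)^(j+1).  The entries of row j are deleted first, so that the index 0 is not shifted. *)

function Pf :: "'a::comm_ring_1 mat \<Rightarrow> 'a"
  where "Pf A = (if dim_row A = 0 then 1 else
    (\<Sum>j\<in>{1..<dim_row A}. (-1) ^ (j + 1) * A $$ (0, j) * Pf (mat_delete (mat_delete A j j) 0 0)))"
  by pat_completeness auto
termination
  by (relation "measure dim_row") (auto simp: mat_delete_def)

declare Pf.simps [simp del]

definition Q_mat :: "int list \<Rightarrow> int mps mat"
  where "Q_mat \<nu> = mat (length \<nu>) (length \<nu>) (\<lambda>(i, j).
    if i < j then Q2 (\<nu> ! i) (\<nu> ! j)
    else if i = j then 0
    else - Q2 (\<nu> ! j) (\<nu> ! i))"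

definition Q :: "int list \<Rightarrow> int mps"
  where "Q \<nu> = (if even (length \<nu>) then Pf (Q_mat \<nu>) else Pf (Q_mat (\<nu> @ [0])))"

definition is_partition :: "int list \<Rightarrow> bool"
  where "is_partition \<nu> \<longleftrightarrow> sorted_wrt (\<ge>) \<nu> \<and> (\<forall>x\<in>set \<nu>. 0 \<le> x)"

(* Zero parts may be repeated. *)

definition is_strict :: "int list \<Rightarrow> bool"
  where "is_strict \<nu> \<longleftrightarrow> distinct (filter (\<lambda>x. x \<noteq> 0) \<nu>)"

(* The 1-based position of p.  In a strict composition it is unique if p is nonzero;
   if zero parts are repeated, ind and Q_remove use the first one. *)

definition ind :: "int list \<Rightarrow> int \<Rightarrow> nat"
  where "ind \<nu> p = (if p \<in> set \<nu> then Suc (LEAST i. i < length \<nu> \<and> \<nu> ! i = p) else 0)"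

definition Q_remove :: "int list \<Rightarrow> int \<Rightarrow> int mps"
  where "Q_remove \<nu> p = (if p \<in> set \<nu> then Q (remove1 p \<nu>) else 0)"

end

(* The relation q(z) q(-z) = 1 for the generating function of the q_n makes Q_(-p, s) vanish for
   all s \<ge> 0 except s = p, where it is 2 (-1)^p.  Hence the first row of the matrix whose Pfaffian
   is Q_((-p) \<lambda>) has at most one nonzero entry, and the expansion along this row is a single term. *)

theory Submission
  imports Defs
begin

(* The substitution z \<mapsto> -z; the library proves that fps_compose is multiplicative only over
   integral domains. *)

definition fps_alternate :: "'a::comm_ring_1 fps \<Rightarrow> 'a fps"
  where "fps_alternate f = Abs_fps (\<lambda>n. (-1) ^ n * fps_nth f n)"

lemma fps_alternate_nth [simp]: "fps_nth (fps_alternate f) n = (-1) ^ n * fps_nth f n"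
  by (simp add: fps_alternate_def)

lemma fps_alternate_1 [simp]: "fps_alternate 1 = 1"
  by (rule fps_ext) simp

lemma fps_alternate_add: "fps_alternate (f + g) = fps_alternate f + fps_alternate g"
  by (rule fps_ext) (simp add: distrib_left)

lemma fps_alternate_diff: "fps_alternate (f - g) = fps_alternate f - fps_alternate g"
  by (rule fps_ext) (simp add: right_diff_distrib)

lemma fps_alternate_X_mult_const [simp]:
  "fps_alternate (fps_X * fps_const c) = - (fps_X * fps_const c)"
  by (rule fps_ext) (auto simp: fps_X_def)

lemma fps_alternate_mult: "fps_alternate (f * g) = fps_alternate f * fps_alternate g"
proof (rule fps_ext)
  fix n
  have sign: "(-1) ^ n = (-1) ^ i * ((-1) ^ (n - i) :: 'a)" if "i \<le> n" for i
    using that by (simp flip: power_add)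
  show "fps_nth (fps_alternate (f * g)) n = fps_nth (fps_alternate f * fps_alternate g) n"
    by (simp add: fps_mult_nth sum_distrib_left sign mult_ac)
qed

text \<open>The substitution turns (1 + z x) / (1 - z x) into (1 - z x) / (1 + z x), so numerators
  and denominators cancel crosswise.\<close>

lemma q_factor_mult_alternate: "fps_alternate (q_factor i) * q_factor i = 1"
proof -
  define u where "u = fps_X * fps_const (mps_var i :: int mps)"
  define v where "v = fps_right_inverse (1 - u) 1"
  have u: "fps_alternate u = - u"
    by (simp add: u_def)
  have v: "(1 - u) * v = 1"
    unfolding u_def v_def by (rule q_factor_denominator)
  then have "fps_alternate ((1 - u) * v) = 1"
    by simp
  \<comment> \<open>Alternating the equation that defines \<open>v\<close> already inverts
    \<open>1 + u\<close>; no explicit series for \<open>v\<close> is needed.\<close>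
  then have v': "(1 + u) * fps_alternate v = 1"
    by (simp add: fps_alternate_mult fps_alternate_diff u)
  have "fps_alternate (q_factor i) * q_factor i
      = ((1 - u) * fps_alternate v) * ((1 + u) * v)"
    by (simp add: q_factor_def fps_alternate_mult fps_alternate_add u flip: u_def v_def)
  also have "\<dots> = ((1 + u) * fps_alternate v) * ((1 - u) * v)"
    by (simp only: mult_ac)
  finally show ?thesis
    by (simp only: v v' mult_1)
qed

lemma prod_q_factor_mult_alternate:
  "fps_alternate (\<Prod>i<k. q_factor i) * (\<Prod>i<k. q_factor i) = 1"
proof (induction k)
  case (Suc k)
  let ?P = "\<Prod>i<k. q_factor i"
  have "fps_alternate (?P * q_factor k) * (?P * q_factor k)
      = (fps_alternate ?P * ?P) * (fps_alternate (q_factor k) * q_factor k)"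
    by (simp only: fps_alternate_mult mult_ac)
  then show ?case
    by (simp only: Suc.IH q_factor_mult_alternate prod.lessThan_Suc mult_1)
qed simp

text \<open>Factors with index at least \<open>K\<close> do not affect the coefficient of a monomial
  in the first \<open>K\<close> variables. The sequence defining \<open>q_gen\<close> is thus
  constant from \<open>K\<close> on, and its limit is the value at \<open>K\<close>.\<close>

lemma q_gen_nth_eq_prod:
  fixes m :: "nat \<Rightarrow>\<^sub>0 nat"
  assumes "\<And>i. i \<ge> K \<Longrightarrow> Poly_Mapping.lookup m i = 0"
  shows "mps_nth (fps_nth q_gen n) m = mps_nth (fps_nth (\<Prod>i<K. q_factor i) n) m"
proof -
  have "mps_nth (fps_nth (\<Prod>i<k. q_factor i) n) m = mps_nth (fps_nth (\<Prod>i<K. q_factor i) n) m"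
    if "k \<ge> K" for k
    using that
  proof (induction k rule: dec_induct)
    case (step k)
    then show ?case
      using q_factor_mult_nth [OF assms, of k] by simp
  qed simp
  then have "(\<lambda>k. mps_nth (fps_nth (\<Prod>i<k. q_factor i) n) m)
      \<longlonglongrightarrow> mps_nth (fps_nth (\<Prod>i<K. q_factor i) n) m"
    by (intro tendsto_eventually eventually_sequentiallyI)
  then show ?thesis
    by (simp add: q_gen_def limI)
qed

lemma mps_nth_fps_mult_nth:
  "mps_nth (fps_nth (f * g) n) m =
    (\<Sum>i = 0..n. \<Sum>(a, b)\<in>monom_splits m. mps_nth (fps_nth f i) a * mps_nth (fps_nth g (n - i)) b)"
  by (simp add: fps_mult_nth mps_nth_sum times_mps_def)

lemma mps_nth_uminus: "mps_nth (- f) m = - mps_nth f m"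
  by (simp add: uminus_mps_def)

lemma mps_nth_uminus_one_power_mult: "mps_nth ((-1) ^ n * f) m = (-1) ^ n * mps_nth f m"
  by (induction n) (simp_all add: mps_nth_uminus)

text \<open>The coefficient at \<open>m\<close> of a product depends only on coefficients at
  divisors of \<open>m\<close>. These contain only variables of \<open>m\<close>, so one bound
  \<open>K\<close> serves them all, and both copies of \<open>q_gen\<close> may be replaced by the
  same finite product.\<close>

lemma q_gen_mult_alternate: "fps_alternate q_gen * q_gen = 1"
proof (rule fps_ext, rule mps_eqI)
  fix n and m :: "nat \<Rightarrow>\<^sub>0 nat"
  obtain K where K: "\<forall>i\<in>Poly_Mapping.keys m. i < K"
    using finite_keys [of m] unfolding finite_nat_set_iff_bounded by blast
  have zero: "Poly_Mapping.lookup a i = 0" "Poly_Mapping.lookup b i = 0"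
    if "(a, b) \<in> monom_splits m" "i \<ge> K" for a b i
  proof -
    have "i \<notin> Poly_Mapping.keys m"
      using K that(2) by (meson leD)
    then have "Poly_Mapping.lookup (a + b) i = 0"
      using that(1) by (simp add: monom_splits_def in_keys_iff)
    then show "Poly_Mapping.lookup a i = 0" "Poly_Mapping.lookup b i = 0"
      by (simp_all add: lookup_add)
  qed
  let ?P = "\<Prod>i<K. q_factor i"
  have "mps_nth (fps_nth (fps_alternate q_gen * q_gen) n) m
      = mps_nth (fps_nth (fps_alternate ?P * ?P) n) m"
    unfolding mps_nth_fps_mult_nth fps_alternate_nth mps_nth_uminus_one_power_mult
    by (intro sum.cong refl) (auto simp: q_gen_nth_eq_prod [OF zero(1)] q_gen_nth_eq_prod [OF zero(2)])
  then show "mps_nth (fps_nth (fps_alternate q_gen * q_gen) n) m = mps_nth (fps_nth 1 n) m"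
    by (simp add: prod_q_factor_mult_alternate)
qed

lemma q_int: "q (int n) = fps_nth q_gen n"
  by (simp add: q_def)

text \<open>This compares coefficients of z^n in q(-z) q(z) = 1.\<close>

lemma q_alternating_sum:
  "(\<Sum>k = 0..n. (-1) ^ k * q (int k) * q (int (n - k))) = (if n = 0 then 1 else 0)"
proof -
  have "fps_nth (fps_alternate q_gen * q_gen) n = (if n = 0 then 1 else 0)"
    by (simp add: q_gen_mult_alternate)
  then show ?thesis
    by (simp only: fps_mult_nth fps_alternate_nth q_int)
qed

lemma Q2_uminus:
  assumes "p > 0" "s \<ge> 0"
  shows "Q2 (- p) s = (if s = p then 2 * (-1) ^ nat p else 0)"
proof -
  let ?f = "\<lambda>i. (-1) ^ nat i * q (- p + i) * q (s - i)"
  \<comment> \<open>For \<open>i < p\<close> the index \<open>- p + i\<close> is negative, so that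
    factor \<open>q\<close> is 0.\<close>
  have "(\<Sum>i = 1..s. ?f i) = (\<Sum>i = p..s. ?f i)"
    using assms by (intro sum.mono_neutral_right) (auto simp: q_def)
  also have "\<dots> = (if s = p then (-1) ^ nat p else 0)"
  proof (cases "p \<le> s")
    case True
    define n where "n = nat (s - p)"
    \<comment> \<open>With \<open>i = p + k\<close> the sign splits as (-1)^p (-1)^k, which leaves
      the alternating sum of total degree \<open>s - p\<close>.\<close>
    have "(\<Sum>i = p..s. ?f i)
        = (\<Sum>k = 0..n. (-1) ^ nat p * ((-1) ^ k * q (int k) * q (int (n - k))))"
      using assms True
      by (intro sum.reindex_bij_witness [where i = "\<lambda>k. p + int k" and j = "\<lambda>i. nat (i - p)"])
        (auto simp: n_def nat_diff_distrib algebra_simps simp flip: power_add)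
    also have "\<dots> = (-1) ^ nat p * (if n = 0 then 1 else 0)"
      by (simp only: q_alternating_sum flip: sum_distrib_left)
    finally show ?thesis
      using True by (auto simp: n_def)
  qed auto
  finally show ?thesis
    using assms by (simp add: Q2_def q_def)
qed

text \<open>The first deletion drops \<open>b\<close>, the second drops \<open>a\<close>. The
  remaining indices keep their relative order, so the signs of the skew-symmetric entries are
  unchanged.\<close>

lemma mat_delete_Q_mat:
  "mat_delete (mat_delete (Q_mat (a # xs @ b # ys)) (Suc (length xs)) (Suc (length xs))) 0 0
    = Q_mat (xs @ ys)"
  by (rule eq_matI) (auto simp: Q_mat_def mat_delete_def nth_append nth_Cons')

text \<open>Column \<open>Suc j\<close> belongs to \<open>xs ! j\<close>; its sign (-1)^(j + 2)
  equals (-1)^j.\<close>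

lemma Pf_Q_mat_Cons:
  "Pf (Q_mat (a # xs)) = (\<Sum>j<length xs. (-1) ^ j * Q2 a (xs ! j) *
    Pf (mat_delete (mat_delete (Q_mat (a # xs)) (Suc j) (Suc j)) 0 0))"
proof -
  have "{1..<dim_row (Q_mat (a # xs))} = Suc ` {..<length xs}"
    by (simp add: Q_mat_def lessThan_atLeast0 flip: image_Suc_atLeastLessThan)
  then show ?thesis
    by (subst Pf.simps) (auto simp: sum.reindex Q_mat_def intro!: sum.cong)
qed

lemma Pf_Q_mat_uminus_notin:
  assumes "p > 0" "\<forall>x\<in>set xs. x \<ge> 0" "p \<notin> set xs"
  shows "Pf (Q_mat (- p # xs)) = 0"
  unfolding Pf_Q_mat_Cons
proof (rule sum.neutral, rule ballI)
  fix j assume "j \<in> {..<length xs}"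
  then have "xs ! j \<in> set xs"
    by simp
  with assms have "Q2 (- p) (xs ! j) = 0"
    by (subst Q2_uminus) auto
  then show "(-1) ^ j * Q2 (- p) (xs ! j) *
      Pf (mat_delete (mat_delete (Q_mat (- p # xs)) (Suc j) (Suc j)) 0 0) = 0"
    by simp
qed

text \<open>Since \<open>p\<close> occurs only once, only column \<open>Suc (length xs)\<close>
  contributes. Entries 0 are allowed in \<open>ys\<close>, so the lemma also covers a list padded by
  0.\<close>

lemma Pf_Q_mat_uminus:
  assumes "p > 0" "\<forall>x\<in>set xs \<union> set ys. x \<ge> 0" "p \<notin> set xs" "p \<notin> set ys"
  shows "Pf (Q_mat (- p # xs @ p # ys)) = (-1) ^ (nat p + length xs) * 2 * Pf (Q_mat (xs @ ys))"
proof -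
  let ?l = "xs @ p # ys" and ?k = "length xs"
  let ?f = "\<lambda>j. (-1) ^ j * Q2 (- p) (?l ! j) *
    Pf (mat_delete (mat_delete (Q_mat (- p # ?l)) (Suc j) (Suc j)) 0 0)"
  have "?f j = 0" if "j \<in> {..<length ?l} - {?k}" for j
  proof -
    have "?l ! j \<in> set xs \<union> set ys"
      using that by (auto simp: nth_append nth_Cons')
    with assms have "Q2 (- p) (?l ! j) = 0"
      by (subst Q2_uminus) auto
    then show ?thesis
      by simp
  qed
  then have "(\<Sum>j<length ?l. ?f j) = (\<Sum>j\<in>{?k}. ?f j)"
    by (intro sum.mono_neutral_right) auto
  also have "\<dots> = (-1) ^ (nat p + ?k) * 2 * Pf (Q_mat (xs @ ys))"
    using assms(1) by (simp add: mat_delete_Q_mat Q2_uminus power_add mult_ac)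
  finally show ?thesis
    by (simp add: Pf_Q_mat_Cons)
qed

lemma ind_append_Cons:
  assumes "p \<notin> set xs"
  shows "ind (xs @ p # ys) p = Suc (length xs)"
proof -
  have "(LEAST i. i < length (xs @ p # ys) \<and> (xs @ p # ys) ! i = p) = length xs"
  proof (rule Least_equality)
    fix i assume "i < length (xs @ p # ys) \<and> (xs @ p # ys) ! i = p"
    then show "length xs \<le> i"
      using assms by (metis linorder_not_less nth_append nth_mem)
  qed simp
  then show ?thesis
    by (simp add: ind_def)
qed

theorem proposition3p5:
  fixes p :: int and \<nu> :: "int list"
  assumes "p > 0"
    and "is_partition \<nu>"
    and "is_strict \<nu>"
  shows "Q (- p # \<nu>) = (-1) ^ (nat p + ind \<nu> p + 1) * 2 * Q_remove \<nu> p"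
proof (cases "p \<in> set \<nu>")
  case False
  \<comment> \<open>The two equations serve the two parities of the length; the padding 0 differs
    from \<open>p\<close> because \<open>p > 0\<close>.\<close>
  then have "Pf (Q_mat (- p # \<nu>)) = 0" "Pf (Q_mat (- p # \<nu> @ [0])) = 0"
    using assms by (auto simp: is_partition_def intro!: Pf_Q_mat_uminus_notin)
  with False show ?thesis
    by (simp add: Q_def Q_remove_def)
next
  case True
  then obtain xs ys where \<nu>: "\<nu> = xs @ p # ys" and xs: "p \<notin> set xs"
    by (meson split_list_first)
  \<comment> \<open>Strictness forbids repeating nonzero parts only, hence the appeal to
    \<open>p > 0\<close>.\<close>
  have ys: "p \<notin> set ys"
    using assms(1,3) by (auto simp: is_strict_def \<nu>)
  have nonneg: "\<forall>x\<in>set xs \<union> set ys. x \<ge> 0"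
    using assms(2) by (auto simp: is_partition_def \<nu>)
  have "Pf (Q_mat (- p # xs @ p # ys)) = (-1) ^ (nat p + length xs) * 2 * Pf (Q_mat (xs @ ys))"
    using assms(1) nonneg xs ys by (rule Pf_Q_mat_uminus)
  \<comment> \<open>The padding 0 is absorbed into the tail. Removing two entries preserves parity,
    so \<open>xs @ ys\<close> is padded exactly when \<open>- p # \<nu>\<close> is.\<close>
  moreover have "Pf (Q_mat (- p # xs @ p # ys @ [0]))
      = (-1) ^ (nat p + length xs) * 2 * Pf (Q_mat (xs @ ys @ [0]))"
    using assms(1) nonneg xs ys by (intro Pf_Q_mat_uminus) auto
  moreover have "Q_remove \<nu> p = Q (xs @ ys)"
    using xs by (simp add: \<nu> Q_remove_def remove1_append)
  moreover have "ind \<nu> p = Suc (length xs)"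
    using xs by (simp add: \<nu> ind_append_Cons)
  \<comment> \<open>The exponent in the claim is \<open>nat p + length xs + 2\<close>, of the same
    parity as \<open>nat p + length xs\<close>.\<close>
  ultimately show ?thesis
    by (simp add: \<nu> Q_def)
qed

end
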